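(* Let $\alpha>0$ be the real number $\alpha\approx 0.1854$ satisfying $(1+\alpha)^{1+\alpha}=(16\alpha)^{\alpha}$. Let $p$ be a probability distribution on a nonempty finite alphabet of $n$ characters, and list the characters as $c_1,\dots,c_n$ so that $p(c_1)\ge p(c_2)\ge\cdots\ge p(c_n)$ (ties broken arbitrarily). Let $k\in\{1,\dots,n\}$ be the largest index such that \[ p(c_k)\;\ge\;\alpha\sum_{i=1}^{k-1}p(c_i) \] (for index $1$ the right-hand side is the empty sum $0$). Then the set $\{c_1,\dots,c_k\}$ of the $k$ most common characters minimizes $\operatorname{cost}(S)$ over all subsets $S$ of the alphabet, where \[ \operatorname{cost}(S):=2\cdot\frac18\sum_{i\in S}p(i)\log_2\!\left(\frac{p(S)}{p(i)}\right)+1-p(S),\qquad p(S):=\sum_{i\in S}p(i). \] That is, encoding the $k$ most common characters minimizes the objective $2L+E$ for the rewind mechanism.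
   Context: A target document is to be guessed one character at a time: at each step the program guesses the next character and is then told the correct one. The score to be minimized is $2L+E$, where $L$ is the length in bytes of the stored data and $E$ is the number of incorrectly guessed characters. In the rewind mechanism one chooses a subset $S$ of the alphabet; a character in $S$ is encoded in a hints file, under the distribution $p$ conditioned on $S$, at a cost of $\log_2(p(S)/p(i))$ bits (equivalently $\frac18\log_2(p(S)/p(i))$ bytes) for character $i\in S$, while each occurrence of a character outside $S$ is not encoded and instead incurs one error. When the next character has distribution $p$, the expected contribution of that character to $2L+E$ is by definition $\operatorname{cost}(S)$ as displayed in the claim; minimizing $2L+E$ for the rewind mechanism means minimizing $\operatorname{cost}(S)$ over all subsets $S$ of the alphabet. Convention: a term $p(i)\log_2(p(S)/p(i))$ with $p(i)=0$ is interpreted as $0$. In particular, $\operatorname{cost}(\varnothing)=1$. *)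

theory Defs
  imports "HOL-Probability.Probability_Mass_Function"
begin

text \<open>
  The factor 2 is the weight of the hints in \<open>2 * L + E\<close>, and 1/8 converts bits to bytes.
  A summand with \<open>pmf p i = 0\<close> vanishes whatever value the logarithm takes, which realises the
  convention that such terms count as 0.
\<close>

definition mass :: "'a pmf \<Rightarrow> 'a set \<Rightarrow> real" where
  "mass p S = (\<Sum>i\<in>S. pmf p i)"

definition cost :: "'a pmf \<Rightarrow> 'a set \<Rightarrow> real" where
  "cost p S = 2 * (1 / 8) * (\<Sum>i\<in>S. pmf p i * log 2 (mass p S / pmf p i)) + 1 - mass p S"

lemma cost_empty: "cost p {} = 1"
  by (simp add: cost_def mass_def)

end

(* Adding a character of probability x to a set of mass M > 0 changes the cost by
   (x / 4) excess(M / x), where excess is increasing and vanishes at 1 / \<alpha>, so the addition pays off exactly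
   when x \<ge> \<alpha> M, and then a more probable character pays off at least as much. If a set
   omits a character while containing a less probable one, either deleting the latter or
   exchanging the two does not increase the cost. Repeating this ends in a set of most
   common characters, and among those sets the cost decreases up to k and increases after. *)
theory Submission
  imports Defs
begin

text \<open>The first two terms are (1 + r) times the binary entropy of 1 / (1 + r): the extra hint
  bits per unit of added probability when r is the ratio of old mass to added probability. The 4 is
  the saved error in bits, since one bit costs 2/8 = 1/4.\<close>

definition excess :: "real \<Rightarrow> real" where
  "excess r = (1 + r) * log 2 (1 + r) - r * log 2 r - 4"

text \<open>Avoiding the quotient \<open>M / x\<close> lets the formula cover x = 0, where it gives
  0.\<close>

definition cost_increment :: "real \<Rightarrow> real \<Rightarrow> real" where
  "cost_increment M x = 1 / 4 * ((M + x) * log 2 (M + x) - M * log 2 M - x * log 2 x) - x"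

text \<open>The derivative at x > 0 is log2((1 + x) / x), which is nonnegative. The left end r = 0
  is treated by direct comparison; it arises when the first character joins the empty set.\<close>

lemma excess_mono:
  assumes "0 \<le> r" "r \<le> s"
  shows "excess r \<le> excess s"
proof (cases "r = 0")
  case True
  have "s * log 2 s \<le> (1 + s) * log 2 (1 + s)"
  proof (cases "s = 0")
    case False
    then have "s > 0" using assms by simp
    then have "s * log 2 s \<le> s * log 2 (1 + s)" by simp
    also have "\<dots> \<le> (1 + s) * log 2 (1 + s)"
      using \<open>s > 0\<close> by (simp add: distrib_right)
    finally show ?thesis .
  qed simp
  then show ?thesis using True by (simp add: excess_def)
next
  case False
  then have "r > 0" using assms by simp
  show ?thesis
  proof (rule DERIV_nonneg_imp_nondecreasing[OF assms(2)])
    fix x assume "r \<le> x" "x \<le> s"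
    then have "x > 0" using \<open>r > 0\<close> by simp
    have "(excess has_real_derivative log 2 (1 + x) - log 2 x) (at x)"
      unfolding excess_def using \<open>x > 0\<close>
      by (auto intro!: derivative_eq_intros simp: add_pos_pos)
    moreover have "log 2 (1 + x) - log 2 x \<ge> 0" using \<open>x > 0\<close> by simp
    ultimately show "\<exists>y. (excess has_real_derivative y) (at x) \<and> 0 \<le> y" by blast
  qed
qed

text \<open>Taking log2 of the equation for \<alpha>, with 16 = 2^4 supplying the 4 in
  \<open>excess\<close>, gives exactly \<alpha> times the claim.\<close>

lemma excess_root:
  assumes "\<alpha> > 0" "(1 + \<alpha>) powr (1 + \<alpha>) = (16 * \<alpha>) powr \<alpha>"
  shows "excess (1 / \<alpha>) = 0"
proof -
  have "log 2 ((1 + \<alpha>) powr (1 + \<alpha>)) = log 2 ((16 * \<alpha>) powr \<alpha>)"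
    using assms(2) by simp
  moreover have "log 2 (16 * \<alpha>) = 4 + log 2 \<alpha>"
  proof -
    have "log 2 (2 ^ 4) = (4::real)" by (subst log_nat_power) auto
    then show ?thesis using assms(1) by (subst log_mult) auto
  qed
  ultimately have root: "(1 + \<alpha>) * log 2 (1 + \<alpha>) = \<alpha> * (4 + log 2 \<alpha>)"
    using assms(1) by (simp add: log_powr)
  have "1 + 1 / \<alpha> = (1 + \<alpha>) / \<alpha>" using assms(1) by (simp add: field_simps)
  then have "log 2 (1 + 1 / \<alpha>) = log 2 (1 + \<alpha>) - log 2 \<alpha>" "log 2 (1 / \<alpha>) = - log 2 \<alpha>"
    using assms(1) by (simp_all add: log_divide)
  then have "excess (1 / \<alpha>)
      = (1 + 1 / \<alpha>) * (log 2 (1 + \<alpha>) - log 2 \<alpha>) - 1 / \<alpha> * - log 2 \<alpha> - 4"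
    by (simp only: excess_def)
  then have "\<alpha> * excess (1 / \<alpha>) = (1 + \<alpha>) * log 2 (1 + \<alpha>) - \<alpha> * (4 + log 2 \<alpha>)"
    using assms(1) by (simp add: field_simps)
  then show ?thesis using root assms(1) by simp
qed

text \<open>Factor out x: writing log (M + x) and log M relative to log x subtracts (M + x) log x -
  M log x, which is the remaining term x log x.\<close>

lemma cost_increment_eq_excess:
  assumes "x > 0" "M \<ge> 0"
  shows "cost_increment M x = x / 4 * excess (M / x)"
proof (cases "M = 0")
  case True
  then show ?thesis by (simp add: cost_increment_def excess_def)
next
  case False
  then have "M > 0" using assms by simp
  have "1 + M / x = (M + x) / x" using assms by (simp add: field_simps)
  then have "log 2 (1 + M / x) = log 2 (M + x) - log 2 x" "log 2 (M / x) = log 2 M - log 2 x"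
    using assms \<open>M > 0\<close> by (simp_all add: log_divide)
  then have "excess (M / x)
      = (1 + M / x) * (log 2 (M + x) - log 2 x) - M / x * (log 2 M - log 2 x) - 4"
    by (simp only: excess_def)
  then have "x * excess (M / x)
      = x * (1 + M / x) * (log 2 (M + x) - log 2 x) - x * (M / x) * (log 2 M - log 2 x) - 4 * x"
    by (simp only: right_diff_distrib mult.assoc mult.commute[of 4])
  moreover have "x * (1 + M / x) = M + x" "x * (M / x) = M"
    using assms by (simp_all add: field_simps)
  ultimately have "x * excess (M / x)
      = (M + x) * (log 2 (M + x) - log 2 x) - M * (log 2 M - log 2 x) - 4 * x"
    by metis
  then show ?thesis by (simp add: cost_increment_def algebra_simps)
qed

section \<open>The threshold \<alpha> and the sign of the increment\<close>

context
  fixes \<alpha> :: real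
  assumes pos: "\<alpha> > 0"
    and root: "(1 + \<alpha>) powr (1 + \<alpha>) = (16 * \<alpha>) powr \<alpha>"
begin

lemma cost_increment_nonpos:
  assumes "M \<ge> 0" "x \<ge> \<alpha> * M"
  shows "cost_increment M x \<le> 0"
proof (cases "x = 0")
  case True
  then show ?thesis by (simp add: cost_increment_def)
next
  case False
  moreover have "x \<ge> 0" using assms pos by (meson mult_nonneg_nonneg order.trans less_imp_le)
  ultimately have "x > 0" by simp
  then have "M / x \<le> 1 / \<alpha>" using assms pos by (simp add: field_simps)
  then have "excess (M / x) \<le> 0"
    using excess_mono[of "M / x" "1 / \<alpha>"] excess_root[OF pos root] \<open>x > 0\<close> assms by simp
  then show ?thesis
    using \<open>x > 0\<close> assms by (simp add: cost_increment_eq_excess mult_nonneg_nonpos)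
qed

lemma cost_increment_nonneg:
  assumes "x \<ge> 0" "x \<le> \<alpha> * M"
  shows "cost_increment M x \<ge> 0"
proof (cases "x = 0")
  case True
  then show ?thesis by (simp add: cost_increment_def)
next
  case False
  then have "x > 0" using assms by simp
  then have "M \<ge> 0" using assms pos by (smt (verit) zero_less_mult_pos)
  have "1 / \<alpha> \<le> M / x" using assms pos \<open>x > 0\<close> by (simp add: field_simps)
  then have "excess (M / x) \<ge> 0"
    using excess_mono[of "1 / \<alpha>" "M / x"] excess_root[OF pos root] pos by simp
  then show ?thesis
    using \<open>x > 0\<close> \<open>M \<ge> 0\<close> by (simp add: cost_increment_eq_excess)
qed

text \<open>Beyond the threshold, \<open>excess (M / x)\<close> is nonpositive, so the larger factor
  y lowers the product, and monotonicity of \<open>excess\<close> lowers it again. Far below the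
  threshold the increment can grow with x.\<close>

lemma cost_increment_antimono:
  assumes "M \<ge> 0" "x \<ge> \<alpha> * M" "x \<le> y"
  shows "cost_increment M y \<le> cost_increment M x"
proof (cases "x = 0")
  case True
  then show ?thesis
    using cost_increment_nonpos[of M y] assms by (simp add: cost_increment_def)
next
  case False
  moreover have "x \<ge> 0" using assms pos by (meson mult_nonneg_nonneg order.trans less_imp_le)
  ultimately have "x > 0" by simp
  then have "y > 0" using assms by simp
  have "excess (M / x) \<le> 0"
    using cost_increment_nonpos[OF assms(1,2)] \<open>x > 0\<close> assms(1)
    by (simp add: cost_increment_eq_excess mult_le_0_iff)
  then have "y / 4 * excess (M / x) \<le> x / 4 * excess (M / x)"
    using assms(3) by (intro mult_right_mono_neg) auto
  moreover have "excess (M / y) \<le> excess (M / x)"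
    using assms \<open>x > 0\<close> \<open>y > 0\<close> by (intro excess_mono) (auto intro!: divide_left_mono)
  then have "y / 4 * excess (M / y) \<le> y / 4 * excess (M / x)"
    using \<open>y > 0\<close> by (intro mult_left_mono) auto
  ultimately have "y / 4 * excess (M / y) \<le> x / 4 * excess (M / x)"
    by linarith
  then show ?thesis
    using \<open>x > 0\<close> \<open>y > 0\<close> assms(1) by (simp add: cost_increment_eq_excess)
qed

end

section \<open>Mass and cost of finite sets\<close>

lemma mass_nonneg: "mass p S \<ge> 0"
  by (simp add: mass_def sum_nonneg)

lemma mass_mono:
  assumes "finite T" "S \<subseteq> T"
  shows "mass p S \<le> mass p T"
  unfolding mass_def using assms by (intro sum_mono2) auto

lemma mass_insert:
  assumes "finite S" "x \<notin> S"
  shows "mass p (insert x S) = mass p S + pmf p x"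
  using assms by (simp add: mass_def)

text \<open>Splitting the logarithm leaves only the mass and a sum of terms independent of the rest
  of the set, so adding one character becomes plain algebra. Characters of probability 0 contribute
  0 on both sides.\<close>

lemma cost_eq:
  assumes "finite S"
  shows "cost p S = 1 / 4 * (mass p S * log 2 (mass p S) - (\<Sum>i\<in>S. pmf p i * log 2 (pmf p i)))
           + 1 - mass p S"
proof -
  have "pmf p i * log 2 (mass p S / pmf p i)
          = pmf p i * log 2 (mass p S) - pmf p i * log 2 (pmf p i)" if "i \<in> S" for i
  proof (cases "pmf p i = 0")
    case False
    then have "pmf p i > 0" by (simp add: less_le)
    moreover have "pmf p i \<le> mass p S"
      using mass_mono[of S "{i}" p] assms that by (simp add: mass_def)
    ultimately show ?thesis by (simp add: log_divide right_diff_distrib)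
  qed simp
  then have "(\<Sum>i\<in>S. pmf p i * log 2 (mass p S / pmf p i))
        = mass p S * log 2 (mass p S) - (\<Sum>i\<in>S. pmf p i * log 2 (pmf p i))"
    by (simp add: mass_def sum_subtractf sum_distrib_right)
  then show ?thesis by (simp add: cost_def)
qed

lemma cost_insert:
  assumes "finite S" "x \<notin> S"
  shows "cost p (insert x S) = cost p S + cost_increment (mass p S) (pmf p x)"
  using assms by (simp add: cost_eq mass_insert cost_increment_def algebra_simps)

section \<open>Reduction of arbitrary index sets to prefixes\<close>

lemma initial_segment:
  fixes I :: "nat set"
  assumes "finite I" "0 \<notin> I" "\<And>i j. \<lbrakk>1 \<le> i; i < j; j \<in> I\<rbrakk> \<Longrightarrow> i \<in> I"
  shows "\<exists>m. I = {1..m}"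
proof (cases "I = {}")
  case True
  then have "I = {1..0}" by simp
  then show ?thesis by blast
next
  case False
  have "I = {1..Max I}"
  proof
    show "I \<subseteq> {1..Max I}"
      using assms(1,2) by (auto simp: Suc_le_eq intro!: gr0I)
    show "{1..Max I} \<subseteq> I"
      using assms(3)[of _ "Max I"] Max_in[OF assms(1) False] by (auto simp: le_less)
  qed
  then show ?thesis by blast
qed

text \<open>The sum of the indices is the termination measure: deleting j removes a positive index,
  and exchanging j for i < j lowers the sum too. When neither move is available, the index set has
  no gap.\<close>

lemma prefix_dominates:
  fixes \<alpha> :: real and c :: "nat \<Rightarrow> 'a" and I :: "nat set"
  assumes pos: "\<alpha> > 0" and root: "(1 + \<alpha>) powr (1 + \<alpha>) = (16 * \<alpha>) powr \<alpha>"
    and inj: "inj_on c {1..n}"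
    and sorted: "\<And>i j. 1 \<le> i \<Longrightarrow> i \<le> j \<Longrightarrow> j \<le> n \<Longrightarrow> pmf p (c i) \<ge> pmf p (c j)"
    and "I \<subseteq> {1..n}"
  shows "\<exists>m\<le>n. cost p (c ` {1..m}) \<le> cost p (c ` I)"
  using \<open>I \<subseteq> {1..n}\<close>
proof (induction "\<Sum>I" arbitrary: I rule: less_induct)
  case less
  have fin: "finite I" using less.prems by (rule finite_subset) simp
  show ?case
  proof (cases "\<exists>i j. 1 \<le> i \<and> i < j \<and> j \<in> I \<and> i \<notin> I")
    case False
    then obtain m where "I = {1..m}"
      using initial_segment[OF fin] less.prems by fastforce
    moreover from this have "m \<le> n" using less.prems by (cases m) auto
    ultimately show ?thesis by blast
  next
    case True
    then obtain i j where ij: "1 \<le> i" "i < j" "j \<in> I" "i \<notin> I" by blast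
    then have range: "i \<in> {1..n}" "j \<in> {1..n}" using less.prems by auto
    \<comment> \<open>Both the current set and its exchanged version extend \<open>J\<close> by one
      character, so their costs differ only in the increment over the same mass.\<close>
    define J where "J = I - {j}"
    have J: "finite J" "J \<subseteq> {1..n}" "i \<notin> J" "j \<notin> J" and I_eq: "I = insert j J"
      using fin less.prems ij by (auto simp: J_def)
    have notin: "c i \<notin> c ` J" "c j \<notin> c ` J"
      using J inj_on_image_mem_iff[OF inj range(1)] inj_on_image_mem_iff[OF inj range(2)]
      by simp_all
    have cI: "cost p (c ` I) = cost p (c ` J) + cost_increment (mass p (c ` J)) (pmf p (c j))"
      using J notin by (simp add: I_eq cost_insert)
    have "\<exists>K :: nat set. \<Sum>K < \<Sum>I \<and> K \<subseteq> {1..n} \<and> cost p (c ` K) \<le> cost p (c ` I)"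
    \<comment> \<open>Below the threshold, deleting \<open>c j\<close> does no harm; above it, the
      likelier \<open>c i\<close> is at least as good an addition to \<open>J\<close>.\<close>
    proof (cases "pmf p (c j) \<le> \<alpha> * mass p (c ` J)")
      case True
      then have "cost p (c ` J) \<le> cost p (c ` I)"
        using cI cost_increment_nonneg[OF pos root, of "pmf p (c j)"] by simp
      moreover have "\<Sum>J < \<Sum>I" using J ij by (simp add: I_eq)
      ultimately show ?thesis using J by blast
    next
      case False
      have "pmf p (c j) \<le> pmf p (c i)" using sorted ij range by simp
      then have "cost_increment (mass p (c ` J)) (pmf p (c i))
          \<le> cost_increment (mass p (c ` J)) (pmf p (c j))"
        using False by (intro cost_increment_antimono[OF pos root] mass_nonneg) auto
      then have "cost p (c ` insert i J) \<le> cost p (c ` I)"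
        using cI J notin by (simp add: cost_insert)
      moreover have "\<Sum>(insert i J) < \<Sum>I" using J ij by (simp add: I_eq)
      moreover have "insert i J \<subseteq> {1..n}" using J range by simp
      ultimately show ?thesis by blast
    qed
    then obtain K where "\<Sum>K < \<Sum>I" "K \<subseteq> {1..n}" and K: "cost p (c ` K) \<le> cost p (c ` I)"
      by blast
    with less.hyps obtain m where "m \<le> n" "cost p (c ` {1..m}) \<le> cost p (c ` K)"
      by blast
    then show ?thesis using K order.trans by blast
  qed
qed

theorem theorem6:
  fixes \<alpha> :: real and p :: "'a pmf" and A :: "'a set" and n k :: nat and c :: "nat \<Rightarrow> 'a"
  assumes "\<alpha> > 0"
    and "(1 + \<alpha>) powr (1 + \<alpha>) = (16 * \<alpha>) powr \<alpha>"
    and "finite A" and "A \<noteq> {}" and "card A = n"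
    and "set_pmf p \<subseteq> A"
    and "bij_betw c {1..n} A"
    and "\<And>i j. 1 \<le> i \<Longrightarrow> i \<le> j \<Longrightarrow> j \<le> n \<Longrightarrow> pmf p (c i) \<ge> pmf p (c j)"
    and "k = Max {m \<in> {1..n}. pmf p (c m) \<ge> \<alpha> * (\<Sum>i\<in>{1..<m}. pmf p (c i))}"
  shows "is_arg_min (cost p) (\<lambda>S. S \<subseteq> A) (c ` {1..k})"
proof -
  note pos = assms(1) and root = assms(2) and sorted = assms(8)
  have inj: "inj_on c {1..n}" and img: "c ` {1..n} = A"
    using assms(7) by (auto simp: bij_betw_def)
  define G where "G = {m \<in> {1..n}. pmf p (c m) \<ge> \<alpha> * (\<Sum>i\<in>{1..<m}. pmf p (c i))}"
  have "n \<ge> 1" using assms(3-5) by (metis One_nat_def Suc_leI card_gt_0_iff)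
  \<comment> \<open>At index 1 the sum is empty, so the test holds; hence \<open>Max G\<close> is a
    genuine maximum.\<close>
  then have "1 \<in> G" by (simp add: G_def)
  have "finite G" by (simp add: G_def)
  have k_eq: "k = Max G" unfolding G_def by (rule assms(9))
  have "k \<in> G" using Max_in[OF \<open>finite G\<close>] \<open>1 \<in> G\<close> k_eq by auto
  \<comment> \<open>The half-open range matches the test in \<open>G\<close>: index m + 1 is
    compared with the mass of the first m characters.\<close>
  have mass_prefix: "mass p (c ` {1..m}) = (\<Sum>i\<in>{1..<Suc m}. pmf p (c i))" if "m \<le> n" for m
    unfolding mass_def atLeastLessThanSuc_atLeastAtMost
    using inj that by (subst sum.reindex) (auto intro: inj_on_subset)
  have extend: "cost p (c ` {1..Suc m})
      = cost p (c ` {1..m}) + cost_increment (mass p (c ` {1..m})) (pmf p (c (Suc m)))"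
    if "Suc m \<le> n" for m
  proof -
    have "c (Suc m) \<notin> c ` {1..m}"
      using that by (subst inj_on_image_mem_iff[OF inj]) auto
    then show ?thesis by (simp add: atLeastAtMostSuc_conv cost_insert)
  qed
  \<comment> \<open>The test at k passes down to every earlier index: the preceding mass only
    shrinks and the probability only grows. So each addition up to k is favourable, starting even
    from the empty prefix m = 0.\<close>
  have down: "cost p (c ` {1..k}) \<le> cost p (c ` {1..m})" if "m \<le> k" for m
    using that
  proof (induction rule: inc_induct)
    case (step m)
    have "k \<le> n" using \<open>k \<in> G\<close> by (simp add: G_def)
    have "\<alpha> * mass p (c ` {1..m}) \<le> \<alpha> * (\<Sum>i\<in>{1..<k}. pmf p (c i))"
      unfolding mass_prefix[OF order.trans[OF less_imp_le[OF step(2)] \<open>k \<le> n\<close>]]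
      using step(2) pos by (intro mult_left_mono sum_mono2) auto
    also have "\<dots> \<le> pmf p (c k)" using \<open>k \<in> G\<close> by (simp add: G_def)
    also have "\<dots> \<le> pmf p (c (Suc m))" using sorted step(2) \<open>k \<le> n\<close> by simp
    finally have "cost p (c ` {1..Suc m}) \<le> cost p (c ` {1..m})"
      using extend[of m] cost_increment_nonpos[OF pos root mass_nonneg] step(2) \<open>k \<le> n\<close>
      by simp
    then show ?case using step.IH by simp
  qed simp
  \<comment> \<open>By maximality of k every later index fails the test, so each further addition
    cannot lower the cost.\<close>
  have up: "cost p (c ` {1..k}) \<le> cost p (c ` {1..m})" if "k \<le> m" "m \<le> n" for m
    using that
  proof (induction rule: dec_induct)
    case (step m)
    have "Suc m \<notin> G" using Max_ge[OF \<open>finite G\<close>, of "Suc m"] step(1) k_eq by auto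
    then have "pmf p (c (Suc m)) \<le> \<alpha> * mass p (c ` {1..m})"
      using step.prems mass_prefix[of m] by (simp add: G_def del: sum.op_ivl_Suc)
    then have "cost p (c ` {1..m}) \<le> cost p (c ` {1..Suc m})"
      using extend[OF step.prems] cost_increment_nonneg[OF pos root pmf_nonneg] by simp
    then show ?case using step.IH step.prems by simp
  qed simp
  have "cost p (c ` {1..k}) \<le> cost p S" if "S \<subseteq> A" for S
  proof -
    obtain I where I: "I \<subseteq> {1..n}" "S = c ` I"
      using \<open>S \<subseteq> A\<close> img by (meson subset_imageE)
    obtain m where m: "m \<le> n" "cost p (c ` {1..m}) \<le> cost p S"
      using prefix_dominates[OF pos root inj sorted I(1)] I(2) by auto
    moreover have "cost p (c ` {1..k}) \<le> cost p (c ` {1..m})"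
      using up down m(1) by (cases "m \<le> k") auto
    ultimately show ?thesis by simp
  qed
  moreover have "c ` {1..k} \<subseteq> A" using img \<open>k \<in> G\<close> by (auto simp: G_def)
  ultimately show ?thesis by (auto simp: is_arg_min_linorder)
qed

end
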